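(* Let $T\ge 2$ be an integer and $p\in(0,1)$. Let $\{U_n\}_{n\ge 0}$ be a sequence of independent random variables with $U_{kT}=1$ almost surely for all $k\ge 0$ and $U_n$ Bernoulli with parameter $p$ for every $n\ge 0$ that is not a multiple of $T$. Let $\{X_n\}_{n\ge 0}$ be a strictly stationary sequence of positive random variables with continuous marginal distribution function $F$, independent of $\{U_n\}_{n\ge 0}$. Define $$Y_n=U_nX_n+(1-U_n)\max_{[(n-1)/T]\,T\le i\le n-1}U_iX_i,\qquad n\ge 1 .$$ Then the sequence $\{Y_n\}_{n\ge 1}$ is $T$-periodic: for every $m\ge 1$, all integers $1\le i_1<i_2<\dots<i_m$ and all real $x_1,\dots,x_m$, $$P\Big(\bigcap_{s=1}^m\{Y_{i_s+T}\le x_s\}\Big)=P\Big(\bigcap_{s=1}^m\{Y_{i_s}\le x_s\}\Big).$$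
   Context: $[a]$ denotes the integer part of the real number $a$. *)

theory Defs
  imports "HOL-Probability.Probability"
begin

text \<open>Equality of all finite-dimensional laws under every time shift.\<close>

definition strictly_stationary :: "'a measure \<Rightarrow> (nat \<Rightarrow> 'a \<Rightarrow> real) \<Rightarrow> bool" where
  "strictly_stationary M X \<longleftrightarrow>
     (\<forall>n. X n \<in> borel_measurable M) \<and>
     (\<forall>h J. finite J \<longrightarrow>
        distr M (\<Pi>\<^sub>M j\<in>J. borel) (\<lambda>\<omega>. \<lambda>j\<in>J. X (j + h) \<omega>) =
        distr M (\<Pi>\<^sub>M j\<in>J. borel) (\<lambda>\<omega>. \<lambda>j\<in>J. X j \<omega>))"

definition bernoulli_rv :: "'a measure \<Rightarrow> real \<Rightarrow> ('a \<Rightarrow> real) \<Rightarrow> bool" where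
  "bernoulli_rv M p V \<longleftrightarrow>
     V \<in> borel_measurable M \<and>
     measure M {\<omega> \<in> space M. V \<omega> = 1} = p \<and>
     measure M {\<omega> \<in> space M. V \<omega> = 0} = 1 - p"

end

theory Submission
  imports Defs
begin

text \<open>Since the block start shifts along with the index, the value at time \<open>n + T\<close> is the same
  functional of the paths shifted by \<open>T\<close> as the value at time \<open>n\<close> is of the unshifted paths. The
  finite-dimensional laws of \<open>U\<close> are invariant under a shift by \<open>T\<close> (independence and periodic
  marginals), those of \<open>X\<close> by stationarity, and independence of \<open>U\<close> and \<open>X\<close> makes the joint law
  the product of the two.\<close>

text \<open>The masses at 1 and 0 add up to 1, so \<open>V\<close> lies in {0, 1} almost surely.
  Hence \<open>p\<close> alone determines the law of \<open>V\<close>.\<close>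

lemma (in prob_space) prob_bernoulli_rv:
  assumes "bernoulli_rv M p V" and A: "A \<in> sets borel"
  shows "prob (V -` A \<inter> space M) = p * indicator A 1 + (1 - p) * indicator A 0"
proof -
  have V[measurable]: "V \<in> borel_measurable M"
    and one: "prob {\<omega> \<in> space M. V \<omega> = 1} = p"
    and zero: "prob {\<omega> \<in> space M. V \<omega> = 0} = 1 - p"
    using assms by (auto simp: bernoulli_rv_def)
  note [measurable] = A
  have "prob ({\<omega> \<in> space M. V \<omega> = 1} \<union> {\<omega> \<in> space M. V \<omega> = 0}) = p + (1 - p)"
    by (subst finite_measure_Union) (auto simp: one zero)
  also have "{\<omega> \<in> space M. V \<omega> = 1} \<union> {\<omega> \<in> space M. V \<omega> = 0} =
      {\<omega> \<in> space M. V \<omega> = 1 \<or> V \<omega> = 0}" by auto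
  finally have "AE \<omega> in M. V \<omega> = 1 \<or> V \<omega> = 0"
    by (subst prob_Collect_eq_1[symmetric]) auto
  hence "prob (V -` A \<inter> space M) = prob ({\<omega> \<in> space M. V \<omega> = 1 \<and> 1 \<in> A} \<union>
      {\<omega> \<in> space M. V \<omega> = 0 \<and> 0 \<in> A})"
    by (intro finite_measure_eq_AE) auto
  also have "\<dots> = prob {\<omega> \<in> space M. V \<omega> = 1 \<and> 1 \<in> A} + prob {\<omega> \<in> space M. V \<omega> = 0 \<and> 0 \<in> A}"
    by (intro finite_measure_Union) auto
  finally show ?thesis
    using one zero by (cases "1 \<in> A"; cases "0 \<in> A") auto
qed

lemma (in prob_space) distr_bernoulli_rv_eq:
  assumes "bernoulli_rv M p V" "bernoulli_rv M p W"
  shows "distr M borel V = distr M borel W"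
proof (rule measure_eqI)
  fix A :: "real set" assume "A \<in> sets (distr M borel V)"
  moreover have "V \<in> borel_measurable M" "W \<in> borel_measurable M"
    using assms by (auto simp: bernoulli_rv_def)
  ultimately show "emeasure (distr M borel V) A = emeasure (distr M borel W) A"
    using assms by (simp add: emeasure_distr emeasure_eq_measure prob_bernoulli_rv)
qed simp

text \<open>Treats the almost surely constant variables at multiples of \<open>T\<close> as
  Bernoulli with parameter 1, so that \<open>distr_bernoulli_rv_eq\<close> also covers them.\<close>

lemma (in prob_space) bernoulli_rv_one:
  assumes [measurable]: "V \<in> borel_measurable M" and "AE \<omega> in M. V \<omega> = 1"
  shows "bernoulli_rv M 1 V"
proof -
  have "prob {\<omega> \<in> space M. V \<omega> = 1} = 1"
    using assms by (subst prob_Collect_eq_1) auto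
  moreover have "prob {\<omega> \<in> space M. V \<omega> = 0} = 0"
    using assms by (subst prob_Collect_eq_0) auto
  ultimately show ?thesis by (simp add: bernoulli_rv_def)
qed

lemma (in prob_space) indep_vars_reindex:
  assumes inj: "inj_on f I" and indep: "indep_vars M' X (f ` I)"
  shows "indep_vars (M' \<circ> f) (X \<circ> f) I"
  unfolding indep_vars_def2
proof (intro conjI indep_setsI ballI)
  show "random_variable ((M' \<circ> f) i) ((X \<circ> f) i)" if "i \<in> I" for i
    using indep that by (auto simp: indep_vars_def2)
  thus "{(X \<circ> f) i -` A \<inter> space M |A. A \<in> sets ((M' \<circ> f) i)} \<subseteq> events" if "i \<in> I" for i
    using that by (auto intro: measurable_sets)
next
  fix A J
  assume J: "J \<noteq> {}" "J \<subseteq> I" "finite J"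
    and A: "\<forall>j\<in>J. A j \<in> {(X \<circ> f) j -` B \<inter> space M |B. B \<in> sets ((M' \<circ> f) j)}"
  have inj_J: "inj_on f J" using inj J(2) by (rule inj_on_subset)
  define g where "g = the_inv_into J f"
  have g: "g (f j) = j" if "j \<in> J" for j
    unfolding g_def using inj_J that by (rule the_inv_into_f_f)
  have "indep_sets (\<lambda>k. {X k -` B \<inter> space M |B. B \<in> sets (M' k)}) (f ` I)"
    using indep by (simp add: indep_vars_def2)
  hence "prob (\<Inter>k\<in>f ` J. A (g k)) = (\<Prod>k\<in>f ` J. prob (A (g k)))"
    by (rule indep_setsD) (use J A g in auto)
  thus "prob (\<Inter>j\<in>J. A j) = (\<Prod>j\<in>J. prob (A j))"
    using inj_J by (simp add: prod.reindex g)
qed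

text \<open>By independence, each side is the product of its marginals, and these agree factor by
  factor.\<close>

lemma (in prob_space) distr_indep_vars_shift:
  fixes U :: "nat \<Rightarrow> 'a \<Rightarrow> real"
  assumes indep: "indep_vars (\<lambda>_. borel) U UNIV"
    and marginal: "\<And>n. distr M borel (U (n + h)) = distr M borel (U n)"
  shows "distr M (\<Pi>\<^sub>M j\<in>J. borel) (\<lambda>\<omega>. \<lambda>j\<in>J. U (j + h) \<omega>) =
         distr M (\<Pi>\<^sub>M j\<in>J. borel) (\<lambda>\<omega>. \<lambda>j\<in>J. U j \<omega>)"
proof (cases "J = {}")
  case True then show ?thesis by (simp add: restrict_def)
next
  case False
  have rv: "random_variable borel (U n)" for n
    using indep by (auto simp: indep_vars_def)
  have "distr M (\<Pi>\<^sub>M j\<in>J. borel) (\<lambda>\<omega>. \<lambda>j\<in>J. U (j + k) \<omega>) =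
      (\<Pi>\<^sub>M j\<in>J. distr M borel (U (j + k)))" for k
  proof -
    have "indep_vars (\<lambda>_. borel) U ((\<lambda>j. j + k) ` J)"
      using indep by (rule indep_vars_subset) simp
    hence "indep_vars ((\<lambda>_. borel) \<circ> (\<lambda>j. j + k)) (U \<circ> (\<lambda>j. j + k)) J"
      by (intro indep_vars_reindex) (auto simp: inj_on_def)
    hence "indep_vars (\<lambda>_. borel) (\<lambda>j. U (j + k)) J"
      by (simp add: o_def)
    thus ?thesis
      by (subst (asm) indep_vars_iff_distr_eq_PiM') (use False rv in auto)
  qed
  from this[of h] this[of 0] marginal show ?thesis by simp
qed

text \<open>The deterministic functional of two paths that produces \<open>Y n\<close>. For
  \<open>n\<close> \<ge> 1 and \<open>T\<close> > 0 the window starts at the last multiple of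
  \<open>T\<close> strictly before \<open>n\<close>, so for \<open>n\<close> a multiple of
  \<open>T\<close> it is the whole preceding block.\<close>

definition max_filter :: "nat \<Rightarrow> nat \<Rightarrow> (nat \<Rightarrow> real) \<Rightarrow> (nat \<Rightarrow> real) \<Rightarrow> real" where
  "max_filter T n u x =
     u n * x n + (1 - u n) * Max ((\<lambda>i. u i * x i) ` {(n - 1) div T * T..n - 1})"

text \<open>Adding \<open>T\<close> moves the block start by exactly \<open>T\<close>. The bound on
  \<open>n\<close> matters because subtraction on naturals truncates:
  \<open>n + T - 1 = n - 1 + T\<close> fails at \<open>n = 0\<close> when \<open>T\<close> >
  0.\<close>

lemma max_filter_shift:
  assumes "1 \<le> n"
  shows "max_filter T (n + T) u x = max_filter T n (\<lambda>j. u (j + T)) (\<lambda>j. x (j + T))"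
proof (cases "T = 0")
  case False
  have "(\<lambda>i. u i * x i) ` {(n - 1) div T * T + T..n - 1 + T} =
      (\<lambda>i. u (i + T) * x (i + T)) ` {(n - 1) div T * T..n - 1}"
    by (simp only: image_add_atLeastAtMost'[symmetric] image_image)
  moreover have "n + T - 1 = n - 1 + T"
    using assms by linarith
  moreover have "(n - 1 + T) div T * T = (n - 1) div T * T + T"
    using False by (simp add: div_add_self2)
  ultimately show ?thesis by (simp only: max_filter_def)
qed (simp add: max_filter_def)

text \<open>Only coordinates up to \<open>n\<close> are read, so the default value of
  \<open>restrict\<close> outside \<open>J\<close> never enters.\<close>

lemma max_filter_restrict:
  assumes "{..n} \<subseteq> J"
  shows "max_filter T n (restrict u J) (restrict x J) = max_filter T n u x"
proof -
  have "(\<lambda>i. restrict u J i * restrict x J i) ` {(n - 1) div T * T..n - 1} =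
      (\<lambda>i. u i * x i) ` {(n - 1) div T * T..n - 1}"
    using assms by (intro image_cong) (auto simp: subset_iff)
  thus ?thesis using assms by (auto simp: max_filter_def subset_iff)
qed

lemma measurable_max_filter:
  assumes "{..n} \<subseteq> J"
  shows "(\<lambda>z. max_filter T n (fst z) (snd z)) \<in>
    borel_measurable ((\<Pi>\<^sub>M j\<in>J. borel) \<Otimes>\<^sub>M (\<Pi>\<^sub>M j\<in>J. borel))"
    (is "_ \<in> borel_measurable ?P")
proof -
  have [measurable]: "(\<lambda>z. fst z i) \<in> borel_measurable ?P" "(\<lambda>z. snd z i) \<in> borel_measurable ?P"
    if "i \<le> n" for i
    using that assms
    by (auto intro!: measurable_compose[OF measurable_fst measurable_component_singleton]
        measurable_compose[OF measurable_snd measurable_component_singleton])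
  have [measurable]: "(\<lambda>z. Max ((\<lambda>i. fst z i * snd z i) ` {(n - 1) div T * T..n - 1}))
      \<in> borel_measurable ?P"
    by (rule borel_measurable_Max) auto
  show ?thesis unfolding max_filter_def by measurable
qed

theorem mainTheorem1:
  fixes M :: "'a measure"
    and T :: nat
    and p :: real
    and U X Y :: "nat \<Rightarrow> 'a \<Rightarrow> real"
    and F :: "real \<Rightarrow> real"
  assumes "prob_space M"
    and "T \<ge> 2"
    and "0 < p" and "p < 1"
    and "prob_space.indep_vars M (\<lambda>_. borel) U UNIV"
    and "\<And>k. AE \<omega> in M. U (k * T) \<omega> = 1"
    and "\<And>n. \<not> T dvd n \<Longrightarrow> bernoulli_rv M p (U n)"
    and "strictly_stationary M X"
    and "\<And>n. AE \<omega> in M. X n \<omega> > 0"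
    and "\<And>n. cdf (distr M borel (X n)) = F"
    and "continuous_on UNIV F"
    and "prob_space.indep_var M
           (\<Pi>\<^sub>M n\<in>UNIV. borel) (\<lambda>\<omega> n. U n \<omega>)
           (\<Pi>\<^sub>M n\<in>UNIV. borel) (\<lambda>\<omega> n. X n \<omega>)"
    and "\<And>n \<omega>. n \<ge> 1 \<Longrightarrow> \<omega> \<in> space M \<Longrightarrow>
           Y n \<omega> = U n \<omega> * X n \<omega> +
             (1 - U n \<omega>) * Max ((\<lambda>i. U i \<omega> * X i \<omega>) ` {(n - 1) div T * T..n - 1})"
  shows "\<forall>m\<ge>1. \<forall>i :: nat \<Rightarrow> nat. \<forall>x :: nat \<Rightarrow> real.
           (\<forall>s\<in>{1..m}. 1 \<le> i s) \<and> strict_mono_on {1..m} i \<longrightarrow>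
           measure M (\<Inter>s\<in>{1..m}. {\<omega> \<in> space M. Y (i s + T) \<omega> \<le> x s}) =
           measure M (\<Inter>s\<in>{1..m}. {\<omega> \<in> space M. Y (i s) \<omega> \<le> x s})"
proof (intro allI impI)
  fix m :: nat and i :: "nat \<Rightarrow> nat" and x :: "nat \<Rightarrow> real"
  assume m: "1 \<le> m" and i: "(\<forall>s\<in>{1..m}. 1 \<le> i s) \<and> strict_mono_on {1..m} i"
  interpret prob_space M by fact
  have U[measurable]: "U n \<in> borel_measurable M" for n
    using assms(5) by (auto simp: indep_vars_def)
  have X[measurable]: "X n \<in> borel_measurable M" for n
    using assms(8) by (auto simp: strictly_stationary_def)
  have Y: "Y n \<omega> = max_filter T n (\<lambda>j. U j \<omega>) (\<lambda>j. X j \<omega>)" if "1 \<le> n" "\<omega> \<in> space M" for n \<omega>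
    using assms(13)[OF that] by (simp add: max_filter_def)
  \<comment> \<open>Shifting by \<open>T\<close> preserves divisibility by \<open>T\<close>, so both
    variables have parameter 1 or both have parameter \<open>p\<close>.\<close>
  have marginal: "distr M borel (U (n + T)) = distr M borel (U n)" for n
  proof (cases "T dvd n")
    case True
    then obtain k where k: "n = k * T" by (auto simp: dvd_def mult.commute)
    have "bernoulli_rv M 1 (U (n + T))" "bernoulli_rv M 1 (U n)"
      using assms(6)[of k] assms(6)[of "Suc k"]
      by (auto intro!: bernoulli_rv_one simp: k add.commute)
    thus ?thesis by (rule distr_bernoulli_rv_eq)
  next
    case False
    thus ?thesis by (intro distr_bernoulli_rv_eq[OF assms(7) assms(7)]) auto
  qed
  \<comment> \<open>An initial segment long enough to contain every time read by the
    \<open>m\<close> values, yet finite, as stationarity of \<open>X\<close> requires.\<close>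
  define J where "J = {..Max (i ` {1..m})}"
  have J: "{..i s} \<subseteq> J" if "s \<in> {1..m}" for s
    using that by (auto simp: J_def intro: order_trans)
  define P where "P = (\<Pi>\<^sub>M j\<in>J. (borel :: real measure))"
  define u where "u h \<omega> = (\<lambda>j\<in>J. U (j + h) \<omega>)" for h \<omega>
  define v where "v h \<omega> = (\<lambda>j\<in>J. X (j + h) \<omega>)" for h \<omega>
  have [measurable]: "u h \<in> measurable M P" "v h \<in> measurable M P" for h
    unfolding u_def v_def P_def by (auto intro!: measurable_restrict)
  have joint: "distr M (P \<Otimes>\<^sub>M P) (\<lambda>\<omega>. (u h \<omega>, v h \<omega>)) =
      distr M P (u h) \<Otimes>\<^sub>M distr M P (v h)" for h
  proof -
    \<comment> \<open>Shifting and restricting is a measurable map on sequence space, so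
      independence of the whole sequences passes to \<open>u h\<close> and
      \<open>v h\<close>.\<close>
    have "(\<lambda>f. \<lambda>j\<in>J. f (j + h)) \<in> measurable (\<Pi>\<^sub>M n\<in>UNIV. (borel :: real measure)) P"
      unfolding P_def by (auto intro!: measurable_restrict measurable_component_singleton)
    from indep_var_compose[OF assms(12) this this]
    have "indep_var P (u h) P (v h)" by (simp add: o_def u_def[abs_def] v_def[abs_def])
    thus ?thesis by (simp add: indep_var_distribution_eq)
  qed
  have "distr M P (u T) = distr M P (u 0)"
    using distr_indep_vars_shift[OF assms(5), of T J] marginal
    by (simp add: u_def[abs_def] P_def J_def)
  moreover have "distr M P (v T) = distr M P (v 0)"
    using assms(8) by (simp add: strictly_stationary_def v_def[abs_def] P_def J_def)
  ultimately have eq: "distr M (P \<Otimes>\<^sub>M P) (\<lambda>\<omega>. (u T \<omega>, v T \<omega>)) =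
      distr M (P \<Otimes>\<^sub>M P) (\<lambda>\<omega>. (u 0 \<omega>, v 0 \<omega>))"
    by (simp add: joint)
  \<comment> \<open>One set, the same for every shift \<open>h\<close>: the two events to compare
    are its preimages under the path pairs for \<open>h = T\<close> and
    \<open>h = 0\<close>.\<close>
  define G where "G = {z \<in> space (P \<Otimes>\<^sub>M P). \<forall>s\<in>{1..m}. max_filter T (i s) (fst z) (snd z) \<le> x s}"
  have [measurable]: "(\<lambda>z. max_filter T (i s) (fst z) (snd z)) \<in> borel_measurable (P \<Otimes>\<^sub>M P)"
    if "s \<in> {1..m}" for s
    unfolding P_def using that by (intro measurable_max_filter J)
  have G[measurable]: "G \<in> sets (P \<Otimes>\<^sub>M P)"
    unfolding G_def by measurable
  \<comment> \<open>Only these two shifts are claimed: \<open>max_filter_shift\<close> relies on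
    block boundaries being mapped to block boundaries.\<close>
  have key: "measure M (\<Inter>s\<in>{1..m}. {\<omega> \<in> space M. Y (i s + h) \<omega> \<le> x s}) =
      measure (distr M (P \<Otimes>\<^sub>M P) (\<lambda>\<omega>. (u h \<omega>, v h \<omega>))) G" if "h = 0 \<or> h = T" for h
  proof -
    have Y_eq: "Y (i s + h) \<omega> = max_filter T (i s) (u h \<omega>) (v h \<omega>)"
      if "s \<in> {1..m}" "\<omega> \<in> space M" for s \<omega>
    proof -
      have is_pos: "1 \<le> i s" using i \<open>s \<in> {1..m}\<close> by blast
      have "Y (i s + h) \<omega> = max_filter T (i s) (\<lambda>j. U (j + h) \<omega>) (\<lambda>j. X (j + h) \<omega>)"
        using \<open>h = 0 \<or> h = T\<close> is_pos \<open>\<omega> \<in> space M\<close> by (auto simp: Y max_filter_shift)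
      thus ?thesis
        unfolding u_def v_def by (subst max_filter_restrict[OF J[OF \<open>s \<in> {1..m}\<close>]])
    qed
    have in_space: "(u h \<omega>, v h \<omega>) \<in> space (P \<Otimes>\<^sub>M P)" if "\<omega> \<in> space M" for \<omega>
      using that by (auto simp: space_pair_measure intro: measurable_space)
    \<comment> \<open>As \<open>m\<close> \<ge> 1, the intersection is over a nonempty index set and
      stays inside \<open>space M\<close>; an empty one would be \<open>UNIV\<close>.\<close>
    have "(\<Inter>s\<in>{1..m}. {\<omega> \<in> space M. Y (i s + h) \<omega> \<le> x s}) =
        {\<omega> \<in> space M. \<forall>s\<in>{1..m}. Y (i s + h) \<omega> \<le> x s}"
      using m by auto
    also have "\<dots> = {\<omega> \<in> space M. \<forall>s\<in>{1..m}. max_filter T (i s) (u h \<omega>) (v h \<omega>) \<le> x s}"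
      by (intro Collect_cong conj_cong refl ball_cong) (simp add: Y_eq)
    also have "\<dots> = (\<lambda>\<omega>. (u h \<omega>, v h \<omega>)) -` G \<inter> space M"
      using in_space by (auto simp: G_def)
    finally show ?thesis by (simp add: measure_distr)
  qed
  show "measure M (\<Inter>s\<in>{1..m}. {\<omega> \<in> space M. Y (i s + T) \<omega> \<le> x s}) =
      measure M (\<Inter>s\<in>{1..m}. {\<omega> \<in> space M. Y (i s) \<omega> \<le> x s})"
    using key[of T] key[of 0] eq by simp
qed

end
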